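(* Let $V$ be an $n$-dimensional vector space with basis $X_1,\dots,X_n$ and write $X_{ij}=X_i\otimes X_j\in V\otimes V$ for $1\le i,j\le n$. The following formulae (for all $1\le i\le j\le k\le l\le n$) define a Poisson bracket on the symmetric algebra $S(V\otimes V)$: \begin{align*} &\{X_{ij},X_{kl}\}=(\delta_{ik}+\delta_{il}+\delta_{jk}+\delta_{jl})X_{ij}X_{kl}-2(X_{il}X_{kj}+X_{ki}X_{lj})\\ &\{X_{ij},X_{lk}\}=(\delta_{ik}+\delta_{il}+\delta_{jk}+\delta_{jl})X_{ij}X_{lk}-2(X_{kj}X_{li}+X_{ik}X_{lj})\\ &\{X_{ji},X_{kl}\}=(\delta_{ik}+\delta_{il}+\delta_{jk}+\delta_{jl})X_{ji}X_{kl}-2(X_{jl}X_{ki}+X_{kj}X_{li})\\ &\{X_{ji},X_{lk}\}=(\delta_{ik}+\delta_{il}+\delta_{jk}+\delta_{jl})X_{ji}X_{lk}-2(X_{jk}X_{li}+X_{ki}X_{lj})\\ &\{X_{ik},X_{jl}\}=(\delta_{ij}+\delta_{il}-\delta_{jk}+\delta_{kl})X_{ik}X_{jl}-2(X_{il}X_{jk}-X_{ij}X_{kl}+X_{ji}X_{lk})\\ &\{X_{ik},X_{lj}\}=(\delta_{ij}+\delta_{il}-\delta_{jk}+\delta_{kl})X_{ik}X_{lj}-2X_{jk}X_{li}\\ &\{X_{ki},X_{jl}\}=(\delta_{ij}+\delta_{il}-\delta_{jk}+\delta_{kl})X_{jl}X_{ki}-2X_{jk}X_{li}\\ &\{X_{ki},X_{lj}\}=(\delta_{ij}+\delta_{il}-\delta_{jk}+\delta_{kl})X_{ki}X_{lj}-2X_{kj}X_{li}\\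 &\{X_{il},X_{jk}\}=(\delta_{ij}+\delta_{ik}-\delta_{jl}-\delta_{kl})X_{il}X_{jk}+2(X_{ij}X_{lk}-X_{ji}X_{kl})\\ &\{X_{il},X_{kj}\}=(\delta_{ij}+\delta_{ik}-\delta_{jl}-\delta_{kl})X_{il}X_{kj}+2(X_{ik}X_{lj}-X_{jl}X_{ki})\\ &\{X_{li},X_{kj}\}=(\delta_{ij}+\delta_{ik}-\delta_{jl}-\delta_{kl})X_{kj}X_{li}\\ &\{X_{li},X_{jk}\}=(\delta_{ij}+\delta_{ik}-\delta_{jl}-\delta_{kl})X_{jk}X_{li} \end{align*}
   Context: $S(V\otimes V)$ is the polynomial algebra in the $n^2$ variables $X_{ij}$ over a field of characteristic $0$ (such as $\mathbb C$); $\delta$ is the Kronecker symbol. "Define a Poisson bracket" means: the formulae are mutually consistent and, extended by bilinearity, skew-symmetry and the Leibniz rule, determine a bracket on $S(V\otimes V)$ satisfying the Jacobi identity. *)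

theory Defs
  imports Complex_Main "HOL-Library.Poly_Mapping" "HOL-Library.FuncSet"
begin

text \<open>
  Polynomials over \<open>'a\<close> in commuting variables indexed by pairs of natural numbers: finitely
  supported families of coefficients indexed by monomials, and a monomial is a finitely supported
  family of exponents. The product on \<^typ>\<open>(nat \<times> nat \<Rightarrow>\<^sub>0 nat) \<Rightarrow>\<^sub>0 'a::comm_ring_1\<close>
  is convolution, i.e. the product of polynomials.
\<close>

type_synonym 'a pair_poly = "(nat \<times> nat \<Rightarrow>\<^sub>0 nat) \<Rightarrow>\<^sub>0 'a"

definition X :: "nat \<Rightarrow> nat \<Rightarrow> 'a::field_char_0 pair_poly" where
  "X i j = Poly_Mapping.single (Poly_Mapping.single (i, j) 1) 1"

definition const :: "'a::field_char_0 \<Rightarrow> 'a pair_poly" where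
  "const c = Poly_Mapping.single 0 c"

text \<open>
  The symmetric algebra of \<open>V \<otimes> V\<close> for \<open>V\<close> with basis \<open>X\<^sub>1, \<dots>, X\<^sub>n\<close>: the polynomials
  all of whose variables are among the \<open>X i j\<close> with \<open>i\<close>, \<open>j\<close> in \<open>{1..n}\<close>.
\<close>

definition sym_tensor_square :: "nat \<Rightarrow> 'a::field_char_0 pair_poly set" where
  "sym_tensor_square n =
     {p. \<forall>m \<in> Poly_Mapping.keys p. Poly_Mapping.keys m \<subseteq> {1..n} \<times> {1..n}}"

definition kronecker :: "nat \<Rightarrow> nat \<Rightarrow> 'a::field_char_0 pair_poly" (\<open>\<delta>\<close>) where
  "\<delta> i j = (if i = j then 1 else 0)"

text \<open>
  Poisson brackets on a subalgebra \<open>A\<close>. As a function, a bracket takes the value \<open>undefined\<close>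
  off \<open>A\<close>, so that two brackets are equal iff they agree on \<open>A\<close>.
\<close>

definition poisson_bracket_on ::
  "'a::field_char_0 pair_poly set \<Rightarrow> ('a pair_poly \<Rightarrow> 'a pair_poly \<Rightarrow> 'a pair_poly) \<Rightarrow> bool" where
  "poisson_bracket_on A B \<longleftrightarrow>
     B \<in> A \<rightarrow>\<^sub>E (A \<rightarrow>\<^sub>E A) \<and>
     (\<forall>f\<in>A. \<forall>g\<in>A. \<forall>h\<in>A. B (f + g) h = B f h + B g h) \<and>
     (\<forall>f\<in>A. \<forall>g\<in>A. \<forall>h\<in>A. B f (g + h) = B f g + B f h) \<and>
     (\<forall>c. \<forall>f\<in>A. \<forall>g\<in>A. B (const c * f) g = const c * B f g) \<and>
     (\<forall>c. \<forall>f\<in>A. \<forall>g\<in>A. B f (const c * g) = const c * B f g) \<and>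
     (\<forall>f\<in>A. \<forall>g\<in>A. B f g = - B g f) \<and>
     (\<forall>f\<in>A. \<forall>g\<in>A. \<forall>h\<in>A. B f (g * h) = B f g * h + g * B f h) \<and>
     (\<forall>f\<in>A. \<forall>g\<in>A. \<forall>h\<in>A. B f (B g h) + B g (B h f) + B h (B f g) = 0)"

end

theory Submission
  imports Defs
begin

text \<open>
  All twelve formulae are instances of a single one, with \<open>s a b\<close> the sign of \<open>a - b\<close>:
  \<open>{X i j, X k l} = (s j l + s i k) X i l X k j + (s j k + 1) X j l X i k + (s i l - 1) X l j X k i\<close>.
  A skew bracket on the variables extends uniquely to a skew biderivation, and the Jacobiator of
  this extension is a derivation in each argument, so that the Jacobi identity need only be checked
  on variables. There the Jacobiator is a combination of differences of cubic monomials
  with the coefficients \<open>s a b * s b c + s b c * s c a + s c a * s a b + 1\<close>, where \<open>a\<close>, \<open>b\<close>, \<open>c\<close>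
  run through the indices of the three variables, one from each. The coefficient vanishes
  unless \<open>a = b = c\<close>, and in that case the two monomials coincide.
\<close>

subsection \<open>Polynomials in a given set of variables\<close>

text \<open>The index type is arbitrary: extending a bracket from the variables does not depend on
  their being indexed by pairs.\<close>

definition var :: "'v \<Rightarrow> ('v \<Rightarrow>\<^sub>0 nat) \<Rightarrow>\<^sub>0 'a::comm_ring_1" where
  "var v = Poly_Mapping.single (Poly_Mapping.single v 1) 1"

definition polys_in :: "'v set \<Rightarrow> (('v \<Rightarrow>\<^sub>0 nat) \<Rightarrow>\<^sub>0 'a::comm_ring_1) set" where
  "polys_in U = {p. \<forall>m \<in> Poly_Mapping.keys p. Poly_Mapping.keys m \<subseteq> U}"

lemma polys_in_single: "Poly_Mapping.keys m \<subseteq> U \<Longrightarrow> Poly_Mapping.single m c \<in> polys_in U"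
  by (auto simp: polys_in_def split: if_splits)

lemma polys_in_0: "0 \<in> polys_in U"
  using polys_in_single[of 0 U 0] by simp

lemma polys_in_1: "1 \<in> polys_in U"
  using polys_in_single[of 0 U 1] by simp

lemma polys_in_var: "v \<in> U \<Longrightarrow> var v \<in> polys_in U"
  unfolding var_def by (rule polys_in_single) simp

lemma polys_in_add: "p \<in> polys_in U \<Longrightarrow> q \<in> polys_in U \<Longrightarrow> p + q \<in> polys_in U"
  unfolding polys_in_def using keys_add[of p q] by blast

lemma polys_in_minus: "p \<in> polys_in U \<Longrightarrow> - p \<in> polys_in U"
  by (simp add: polys_in_def in_keys_iff)

lemma polys_in_diff: "p \<in> polys_in U \<Longrightarrow> q \<in> polys_in U \<Longrightarrow> p - q \<in> polys_in U"
  using polys_in_add[of p U "- q"] by (simp add: polys_in_minus)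

lemma polys_in_mult: "p \<in> polys_in U \<Longrightarrow> q \<in> polys_in U \<Longrightarrow> p * q \<in> polys_in U"
  unfolding polys_in_def
proof safe
  fix m v
  assume p: "\<forall>m\<in>Poly_Mapping.keys p. Poly_Mapping.keys m \<subseteq> U"
    and q: "\<forall>m\<in>Poly_Mapping.keys q. Poly_Mapping.keys m \<subseteq> U"
    and m: "m \<in> Poly_Mapping.keys (p * q)" and v: "v \<in> Poly_Mapping.keys m"
  from m obtain a b where "m = a + b" "a \<in> Poly_Mapping.keys p" "b \<in> Poly_Mapping.keys q"
    using keys_mult[of p q] by blast
  with p q v show "v \<in> U" using keys_add[of a b] by blast
qed

lemma polys_in_UNIV: "p \<in> polys_in UNIV"
  by (simp add: polys_in_def)

lemma poly_mapping_sum_singles: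
  "p = (\<Sum>m\<in>Poly_Mapping.keys p. Poly_Mapping.single m (Poly_Mapping.lookup p m))"
  by (rule poly_mapping_eqI)
    (auto simp: lookup_sum lookup_single when_def sum.delta not_in_keys_iff_lookup_eq_zero)

lemma single_monomial_split:
  "Poly_Mapping.single (m::'v \<Rightarrow>\<^sub>0 nat) (c::'a::comm_ring_1) =
     Poly_Mapping.single 0 c * (\<Prod>v\<in>Poly_Mapping.keys m. var v ^ Poly_Mapping.lookup m v)"
proof -
  have power: "var v ^ k = Poly_Mapping.single (Poly_Mapping.single v k) (1::'a)" for v :: 'v and k
    by (induction k) (simp_all add: var_def mult_single single_add[symmetric])
  have "(\<Prod>v\<in>S. var v ^ Poly_Mapping.lookup m v) =
      Poly_Mapping.single (\<Sum>v\<in>S. Poly_Mapping.single v (Poly_Mapping.lookup m v)) (1::'a)"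
    if "finite S" for S
    using that by induction (simp_all add: power mult_single)
  \<comment> \<open>Here \<open>poly_mapping_sum_singles\<close> is applied to the exponent family
    \<open>m\<close>, not to a polynomial.\<close>
  from this[OF finite_keys[of m]] show ?thesis
    by (simp add: mult_single poly_mapping_sum_singles[symmetric])
qed

text \<open>Restricting the \<open>single\<close> case to monomials that occur in \<open>p\<close>
  lets a constraint on those monomials, such as \<open>p \<in> polys_in U\<close>, enter the
  induction.\<close>

lemma poly_mapping_add_induct [case_names single add zero]:
  assumes single: "\<And>m c. m \<in> Poly_Mapping.keys p \<Longrightarrow> P (Poly_Mapping.single m c)"
    and add: "\<And>p q. P p \<Longrightarrow> P q \<Longrightarrow> P (p + q)"
    and zero: "P 0"
  shows "P (p :: 'v \<Rightarrow>\<^sub>0 'a::comm_monoid_add)"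
proof -
  have "P (\<Sum>m\<in>S. Poly_Mapping.single m (Poly_Mapping.lookup p m))"
    if "finite S" "S \<subseteq> Poly_Mapping.keys p" for S
    using that by induction (auto intro: zero single add)
  from this[OF finite_keys order_refl] show ?thesis
    by (simp flip: poly_mapping_sum_singles)
qed

text \<open>Constants and the variables in \<open>U\<close> generate \<open>polys_in U\<close> as a
  ring. The cases \<open>add\<close> and \<open>mult\<close> retain membership because a Poisson
  bracket on a subalgebra obeys its laws only there.\<close>

lemma polys_in_induct [consumes 1, case_names const var add mult]:
  assumes "p \<in> polys_in U"
    and const: "\<And>c. P (Poly_Mapping.single 0 c)"
    and var: "\<And>v. v \<in> U \<Longrightarrow> P (var v)"
    and add: "\<And>p q. p \<in> polys_in U \<Longrightarrow> q \<in> polys_in U \<Longrightarrow> P p \<Longrightarrow> P q \<Longrightarrow> P (p + q)"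
    and mult: "\<And>p q. p \<in> polys_in U \<Longrightarrow> q \<in> polys_in U \<Longrightarrow> P p \<Longrightarrow> P q \<Longrightarrow> P (p * q)"
  shows "P p"
proof -
  let ?Q = "\<lambda>p. p \<in> polys_in U \<and> P p"
  have one: "?Q 1"
    using const[of 1] polys_in_1 by simp
  have zero: "?Q 0"
    using const[of 0] polys_in_0 by simp
  have power: "?Q (var v ^ k)" if "v \<in> U" for v k
    by (induction k) (use that one in \<open>auto intro: mult var polys_in_mult polys_in_var\<close>)
  have prod: "?Q (\<Prod>v\<in>S. var v ^ e v)" if "finite S" "S \<subseteq> U" for S e
    using that by induction (use one power in \<open>auto intro: mult polys_in_mult\<close>)
  have single: "?Q (Poly_Mapping.single m c)" if "m \<in> Poly_Mapping.keys p" for m c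
  proof -
    have "Poly_Mapping.keys m \<subseteq> U"
      using that assms(1) by (simp add: polys_in_def)
    from prod[OF finite_keys this, of "Poly_Mapping.lookup m"] show ?thesis
      using const polys_in_single[of 0 U c]
      by (subst (1 2) single_monomial_split) (simp add: mult polys_in_mult)
  qed
  have "?Q p"
    by (rule poly_mapping_add_induct) (simp_all add: single zero add polys_in_add)
  then show ?thesis ..
qed

text \<open>The zeros of a derivation are closed under sums and products, so vanishing on generators
  suffices. Skew-symmetry, the Jacobi identity and uniqueness are each reduced to variables in this
  way.\<close>

lemma derivation_eq_0:
  assumes "p \<in> polys_in U"
    and "\<And>c. D (Poly_Mapping.single 0 c) = 0"
    and "\<And>v. v \<in> U \<Longrightarrow> D (var v) = 0"
    and "\<And>p q. p \<in> polys_in U \<Longrightarrow> q \<in> polys_in U \<Longrightarrow> D (p + q) = D p + D q"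
    and "\<And>p q. p \<in> polys_in U \<Longrightarrow> q \<in> polys_in U \<Longrightarrow> D (p * q) = D p * q + p * D q"
  shows "D p = (0 :: ('v \<Rightarrow>\<^sub>0 nat) \<Rightarrow>\<^sub>0 'a::comm_ring_1)"
  using assms(1) by (induction rule: polys_in_induct) (simp_all add: assms(2-))

subsection \<open>Derivations and biderivations with prescribed values on the variables\<close>

text \<open>The sum of the partial derivatives of \<open>p\<close> weighted by \<open>D v\<close>,
  monomial by monomial. Truncated subtraction of exponents is harmless, as the sum only meets
  variables that divide \<open>m\<close>.\<close>

definition derivation_extending ::
  "('v \<Rightarrow> ('v \<Rightarrow>\<^sub>0 nat) \<Rightarrow>\<^sub>0 'a::comm_ring_1) \<Rightarrow> (('v \<Rightarrow>\<^sub>0 nat) \<Rightarrow>\<^sub>0 'a) \<Rightarrow> ('v \<Rightarrow>\<^sub>0 nat) \<Rightarrow>\<^sub>0 'a" where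
  "derivation_extending D p = (\<Sum>m\<in>Poly_Mapping.keys p. \<Sum>v\<in>Poly_Mapping.keys m.
     Poly_Mapping.single (m - Poly_Mapping.single v 1)
       (of_nat (Poly_Mapping.lookup m v) * Poly_Mapping.lookup p m) * D v)"

lemma derivation_extending_add:
  "derivation_extending D (p + q) = derivation_extending D p + derivation_extending D q"
  unfolding derivation_extending_def
  by (rule setsum_keys_plus_distrib)
    (simp_all add: distrib_left single_add distrib_right sum.distrib)

text \<open>Variables outside \<open>m\<close> contribute the coefficient 0. With a common index set
  \<open>S\<close>, two monomials and their product can be differentiated by sums over the same
  variables.\<close>

lemma derivation_extending_single:
  assumes "finite S" "Poly_Mapping.keys m \<subseteq> S"
  shows "derivation_extending D (Poly_Mapping.single m c) =
    (\<Sum>v\<in>S. Poly_Mapping.single (m - Poly_Mapping.single v 1) (of_nat (Poly_Mapping.lookup m v) * c) * D v)"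
proof -
  have "derivation_extending D (Poly_Mapping.single m c) = (\<Sum>v\<in>Poly_Mapping.keys m.
      Poly_Mapping.single (m - Poly_Mapping.single v 1) (of_nat (Poly_Mapping.lookup m v) * c) * D v)"
    by (simp add: derivation_extending_def)
  also have "\<dots> = (\<Sum>v\<in>S. Poly_Mapping.single (m - Poly_Mapping.single v 1)
      (of_nat (Poly_Mapping.lookup m v) * c) * D v)"
    by (rule sum.mono_neutral_left) (use assms in \<open>auto simp: in_keys_iff\<close>)
  finally show ?thesis .
qed

lemma derivation_extending_const [simp]: "derivation_extending D (Poly_Mapping.single 0 c) = 0"
  by (simp add: derivation_extending_def)

lemma derivation_extending_var [simp]: "derivation_extending D (var v) = D v"
  by (simp add: derivation_extending_def var_def)

lemma monomial_minus_plus: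
  assumes "Poly_Mapping.lookup m v \<noteq> 0"
  shows "m - Poly_Mapping.single v 1 + m' = m + m' - Poly_Mapping.single v (1::nat)"
  by (rule poly_mapping_eqI) (use assms in \<open>auto simp: lookup_add lookup_minus lookup_single when_def\<close>)

text \<open>The exponent of \<open>v\<close> in a product of monomials is the sum of the two
  exponents, which splits each summand into two Leibniz terms. Additivity extends the rule to
  polynomials, first in \<open>q\<close>, then in \<open>p\<close>.\<close>

lemma derivation_extending_mult:
  fixes D :: "'v \<Rightarrow> ('v \<Rightarrow>\<^sub>0 nat) \<Rightarrow>\<^sub>0 'a::comm_ring_1"
  shows "derivation_extending D (p * q) = derivation_extending D p * q + p * derivation_extending D q"
proof -
  have mono: "derivation_extending D (Poly_Mapping.single m a * Poly_Mapping.single m' b) =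
      derivation_extending D (Poly_Mapping.single m a) * Poly_Mapping.single m' b +
      Poly_Mapping.single m a * derivation_extending D (Poly_Mapping.single m' b)" for m m' a b
  proof -
    let ?S = "Poly_Mapping.keys m \<union> Poly_Mapping.keys m'"
    let ?e = "\<lambda>v. Poly_Mapping.single v (1::nat)"
    \<comment> \<open>If \<open>v\<close> does not occur in \<open>n\<close>, both coefficients are
      0; otherwise removing one \<open>v\<close> commutes with multiplying by
      \<open>n'\<close>.\<close>
    have *: "Poly_Mapping.single (n - ?e v) (of_nat (Poly_Mapping.lookup n v) * c) * Poly_Mapping.single n' d
        = Poly_Mapping.single (n + n' - ?e v) (of_nat (Poly_Mapping.lookup n v) * (c * d))" for n n' :: "'v \<Rightarrow>\<^sub>0 nat" and v and c d :: 'a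
      by (cases "Poly_Mapping.lookup n v = 0") (simp_all add: mult_single monomial_minus_plus mult.assoc del: One_nat_def)
    have "Poly_Mapping.single (m + m' - ?e v) (of_nat (Poly_Mapping.lookup (m + m') v) * (a * b)) * D v =
      (Poly_Mapping.single (m - ?e v) (of_nat (Poly_Mapping.lookup m v) * a) * D v) * Poly_Mapping.single m' b +
      Poly_Mapping.single m a * (Poly_Mapping.single (m' - ?e v) (of_nat (Poly_Mapping.lookup m' v) * b) * D v)" for v
    proof -
      have "Poly_Mapping.single (m + m' - ?e v) (of_nat (Poly_Mapping.lookup (m + m') v) * (a * b)) =
        Poly_Mapping.single (m - ?e v) (of_nat (Poly_Mapping.lookup m v) * a) * Poly_Mapping.single m' b +
        Poly_Mapping.single (m' - ?e v) (of_nat (Poly_Mapping.lookup m' v) * b) * Poly_Mapping.single m a"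
        unfolding * by (simp add: lookup_add distrib_left distrib_right single_add add.commute mult.commute)
      then show ?thesis by (simp add: algebra_simps)
    qed
    then have "(\<Sum>v\<in>?S. Poly_Mapping.single (m + m' - ?e v) (of_nat (Poly_Mapping.lookup (m + m') v) * (a * b)) * D v) =
      (\<Sum>v\<in>?S. Poly_Mapping.single (m - ?e v) (of_nat (Poly_Mapping.lookup m v) * a) * D v) * Poly_Mapping.single m' b +
      Poly_Mapping.single m a * (\<Sum>v\<in>?S. Poly_Mapping.single (m' - ?e v) (of_nat (Poly_Mapping.lookup m' v) * b) * D v)"
      by (simp only: sum.distrib sum_distrib_left sum_distrib_right)
    moreover have "derivation_extending D (Poly_Mapping.single n c) = (\<Sum>v\<in>?S.
        Poly_Mapping.single (n - ?e v) (of_nat (Poly_Mapping.lookup n v) * c) * D v)"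
      if "Poly_Mapping.keys n \<subseteq> ?S" for n and c :: 'a
      by (rule derivation_extending_single) (use that in auto)
    moreover have "Poly_Mapping.keys (m + m') \<subseteq> ?S" by (rule keys_add)
    ultimately show ?thesis
      by (simp only: mult_single Un_upper1 Un_upper2)
  qed
  have zero: "derivation_extending D 0 = 0"
    by (simp add: derivation_extending_def)
  have left: "derivation_extending D (Poly_Mapping.single m a * q) =
      derivation_extending D (Poly_Mapping.single m a) * q + Poly_Mapping.single m a * derivation_extending D q" for m a
    by (induction q rule: poly_mapping_add_induct)
      (simp_all add: mono zero derivation_extending_add distrib_left)
  show ?thesis
    by (induction p rule: poly_mapping_add_induct)
      (simp_all add: left zero derivation_extending_add distrib_right)
qed

lemma derivation_extending_uminus: "derivation_extending D (- p) = - derivation_extending D p"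
  using derivation_extending_add[of D p "- p"] derivation_extending_const[of D 0]
  by (simp add: eq_neg_iff_add_eq_0 add.commute)

lemma derivation_extending_diff: "derivation_extending D (p - q) = derivation_extending D p - derivation_extending D q"
  using derivation_extending_add[of D p "- q"] by (simp add: derivation_extending_uminus)

text \<open>Linearity in the prescribed values \<open>D\<close>, here and for polynomial factors
  below, makes a biderivation a derivation in its second argument, which enters through these
  values.\<close>

lemma derivation_extending_plus_fun:
  "derivation_extending (\<lambda>v. D v + E v) p = derivation_extending D p + derivation_extending E p"
  by (simp add: derivation_extending_def distrib_left sum.distrib)

lemma derivation_extending_mult_fun:
  "derivation_extending (\<lambda>v. q * D v) p = q * derivation_extending D p"
  "derivation_extending (\<lambda>v. D v * q) p = derivation_extending D p * q"
  by (simp_all add: derivation_extending_def sum_distrib_left sum_distrib_right mult.left_commute mult.assoc)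

lemma derivation_extending_in:
  assumes "p \<in> polys_in U" "\<And>v. v \<in> U \<Longrightarrow> D v \<in> polys_in U"
  shows "derivation_extending D p \<in> polys_in U"
  using assms(1)
proof (induction rule: polys_in_induct)
  case (const c)
  show ?case by (simp add: polys_in_0)
qed (simp_all add: assms(2) derivation_extending_add derivation_extending_mult polys_in_add polys_in_mult)

section \<open>Biderivations: skew-symmetry and the Jacobi identity from the variables\<close>

definition biderivation_extending ::
  "('v \<Rightarrow> 'v \<Rightarrow> ('v \<Rightarrow>\<^sub>0 nat) \<Rightarrow>\<^sub>0 'a::comm_ring_1) \<Rightarrow>
    (('v \<Rightarrow>\<^sub>0 nat) \<Rightarrow>\<^sub>0 'a) \<Rightarrow> (('v \<Rightarrow>\<^sub>0 nat) \<Rightarrow>\<^sub>0 'a) \<Rightarrow> ('v \<Rightarrow>\<^sub>0 nat) \<Rightarrow>\<^sub>0 'a" where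
  "biderivation_extending b f g = derivation_extending (\<lambda>u. derivation_extending (b u) g) f"

lemma biderivation_extending_var [simp]: "biderivation_extending b (var u) (var v) = b u v"
  by (simp add: biderivation_extending_def)

lemma biderivation_extending_in:
  assumes "f \<in> polys_in U" "g \<in> polys_in U" "\<And>u v. u \<in> U \<Longrightarrow> v \<in> U \<Longrightarrow> b u v \<in> polys_in U"
  shows "biderivation_extending b f g \<in> polys_in U"
  unfolding biderivation_extending_def using assms by (intro derivation_extending_in) auto

lemma biderivation_extending_const:
  "biderivation_extending b (Poly_Mapping.single 0 c) g = 0"
  "biderivation_extending b f (Poly_Mapping.single 0 c) = 0"
  by (simp_all add: biderivation_extending_def) (simp add: derivation_extending_def)

lemma biderivation_extending_add:
  "biderivation_extending b (f + g) h = biderivation_extending b f h + biderivation_extending b g h"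
  "biderivation_extending b f (g + h) = biderivation_extending b f g + biderivation_extending b f h"
  by (simp_all add: biderivation_extending_def derivation_extending_add derivation_extending_plus_fun)

lemma biderivation_extending_mult:
  "biderivation_extending b (f * g) h = biderivation_extending b f h * g + f * biderivation_extending b g h"
  "biderivation_extending b f (g * h) = biderivation_extending b f g * h + g * biderivation_extending b f h"
  by (simp_all add: biderivation_extending_def derivation_extending_mult derivation_extending_plus_fun
      derivation_extending_mult_fun)

text \<open>The symmetrisation \<open>?B f g + ?B g f\<close> is a derivation in each argument and
  vanishes on pairs of variables.\<close>

lemma biderivation_extending_skew:
  fixes b :: "'v \<Rightarrow> 'v \<Rightarrow> ('v \<Rightarrow>\<^sub>0 nat) \<Rightarrow>\<^sub>0 'a::comm_ring_1"
  assumes b: "\<And>u v. b u v = - b v u"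
  shows "biderivation_extending b f g = - biderivation_extending b g f"
proof -
  let ?B = "biderivation_extending b"
  note rules = biderivation_extending_const biderivation_extending_add biderivation_extending_mult
  have var: "?B (var v) g + ?B g (var v) = 0" for v
  proof (rule derivation_eq_0[OF polys_in_UNIV, where p = g and D = "\<lambda>g. ?B (var v) g + ?B g (var v)"])
    show "?B (var v) (var u) + ?B (var u) (var v) = 0" for u
      using b[of u v] by simp
  qed (simp_all add: rules algebra_simps)
  have "?B f g + ?B g f = 0"
  proof (rule derivation_eq_0[OF polys_in_UNIV, where p = f and D = "\<lambda>f. ?B f g + ?B g f"])
    show "?B (var v) g + ?B g (var v) = 0" for v by (rule var)
  qed (simp_all add: rules algebra_simps)
  then show ?thesis by (simp add: eq_neg_iff_add_eq_0)
qed

text \<open>The Jacobiator is a derivation in its first argument and invariant under cyclic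
  rotation, so each argument in turn can be moved to the first place and extended from variables to
  polynomials.\<close>

lemma biderivation_extending_jacobi:
  fixes b :: "'v \<Rightarrow> 'v \<Rightarrow> ('v \<Rightarrow>\<^sub>0 nat) \<Rightarrow>\<^sub>0 'a::comm_ring_1"
  defines "B \<equiv> biderivation_extending b"
  assumes skew: "\<And>u v. b u v = - b v u"
    and jacobi: "\<And>u v w. B (var u) (b v w) + B (var v) (b w u) + B (var w) (b u v) = 0"
  shows "B f (B g h) + B g (B h f) + B h (B f g) = 0"
proof -
  note rules = biderivation_extending_const[of b, folded B_def]
    biderivation_extending_add[of b, folded B_def] biderivation_extending_mult[of b, folded B_def]
  have skew_B: "B f g = - B g f" for f g
    unfolding B_def by (rule biderivation_extending_skew) (rule skew)
  have zero: "B f 0 = 0" for f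
    using rules(2)[of f 0] by simp
  define J where "J = (\<lambda>f g h. B f (B g h) + B g (B h f) + B h (B f g))"
  have J_const: "J (Poly_Mapping.single 0 c) g h = 0" for c g h
    by (simp add: J_def rules zero)
  have J_add: "J (p + q) g h = J p g h + J q g h" for p q g h
    by (simp add: J_def rules)
  have J_mult: "J (p * q) g h = J p g h * q + p * J q g h" for p q g h
  proof -
    \<comment> \<open>The cross terms of the nested Leibniz expansions pair up into sums that vanish
      by skew-symmetry.\<close>
    have "J (p * q) g h = J p g h * q + p * J q g h + (B g p + B p g) * B h q + B h p * (B g q + B q g)"
      by (simp add: J_def rules algebra_simps)
    then show ?thesis using skew_B[of g p] skew_B[of g q] by simp
  qed
  have J_cycle: "J f g h = J g h f" for f g h
    by (simp add: J_def)
  have J_eq_0: "J f g h = 0" if "\<And>v. J (var v) g h = 0" for f g h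
    by (rule derivation_eq_0[OF polys_in_UNIV, where D = "\<lambda>f. J f g h"]) (use that in \<open>simp_all add: J_const J_add J_mult\<close>)
  \<comment> \<open>Three rounds follow: extend the first argument, rotate, repeat.\<close>
  have "J (var u) (var v) (var w) = 0" for u v w
    using jacobi[of u v w] by (simp add: J_def B_def)
  then have "J f (var v) (var w) = 0" for f v w
    by (rule J_eq_0)
  then have "J (var v) (var w) f = 0" for f v w
    using J_cycle[of f "var v" "var w"] by simp
  then have "J g (var w) f = 0" for f g w
    by (rule J_eq_0)
  then have "J (var w) f g = 0" for f g w
    using J_cycle[of g "var w" f] by simp
  then have "J f g h = 0"
    by (rule J_eq_0)
  then show ?thesis by (simp add: J_def)
qed

subsection \<open>Poisson brackets\<close>

lemma poisson_bracket_onD: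
  assumes "poisson_bracket_on A B"
  shows "B \<in> A \<rightarrow>\<^sub>E (A \<rightarrow>\<^sub>E A)"
    and "f \<in> A \<Longrightarrow> g \<in> A \<Longrightarrow> B f g = - B g f"
    and "f \<in> A \<Longrightarrow> g \<in> A \<Longrightarrow> h \<in> A \<Longrightarrow> B f (g + h) = B f g + B f h"
    and "f \<in> A \<Longrightarrow> g \<in> A \<Longrightarrow> h \<in> A \<Longrightarrow> B f (g * h) = B f g * h + g * B f h"
    and "f \<in> A \<Longrightarrow> g \<in> A \<Longrightarrow> B f (const c * g) = const c * B f g"
  using assms unfolding poisson_bracket_on_def by meson+

text \<open>Leibniz on \<open>1 = 1 * 1\<close> gives \<open>B f 1 = B f 1 + B f 1\<close>, and
  scalars pull out.\<close>

lemma poisson_bracket_on_const: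
  assumes B: "poisson_bracket_on (polys_in U) B" and f: "f \<in> polys_in U"
  shows "B f (Poly_Mapping.single 0 c) = 0"
proof -
  have "B f 1 = 0"
    using poisson_bracket_onD(4)[OF B f polys_in_1 polys_in_1] by simp
  with poisson_bracket_onD(5)[OF B f polys_in_1, of c] show ?thesis
    by (simp add: const_def)
qed

text \<open>For a fixed first argument the difference of the brackets is a derivation in the second,
  so agreement on variables spreads there; skew-symmetry carries it over to the first.\<close>

lemma poisson_bracket_on_eqI:
  fixes B C :: "'a::field_char_0 pair_poly \<Rightarrow> 'a pair_poly \<Rightarrow> 'a pair_poly"
  assumes B: "poisson_bracket_on (polys_in U) B" and C: "poisson_bracket_on (polys_in U) C"
    and eq: "\<And>u v. u \<in> U \<Longrightarrow> v \<in> U \<Longrightarrow> B (var u) (var v) = C (var u) (var v)"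
  shows "B = C"
proof -
  let ?A = "polys_in U"
  have agree: "B f p = C f p" if f: "f \<in> ?A" and p: "p \<in> ?A"
    and *: "\<And>v. v \<in> U \<Longrightarrow> B f (var v) = C f (var v)" for f p
  proof -
    have "B f p - C f p = 0"
    proof (rule derivation_eq_0[OF p, where D = "\<lambda>p. B f p - C f p"])
      show "B f (var v) - C f (var v) = 0" if "v \<in> U" for v using *[OF that] by simp
      show "B f (Poly_Mapping.single 0 c) - C f (Poly_Mapping.single 0 c) = 0" for c
        by (simp add: poisson_bracket_on_const[OF B f] poisson_bracket_on_const[OF C f])
      fix p q :: "'a pair_poly" assume "p \<in> ?A" "q \<in> ?A"
      then show "B f (p + q) - C f (p + q) = B f p - C f p + (B f q - C f q)"
        and "B f (p * q) - C f (p * q) = (B f p - C f p) * q + p * (B f q - C f q)"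
        by (simp_all add: poisson_bracket_onD(3,4)[OF B f] poisson_bracket_onD(3,4)[OF C f] algebra_simps)
    qed
    then show ?thesis by simp
  qed
  have var: "B (var u) g = C (var u) g" if "u \<in> U" "g \<in> ?A" for u g
    by (rule agree[OF polys_in_var[OF that(1)] that(2)]) (simp add: eq that)
  have gens: "B g f = C g f" if f: "f \<in> ?A" and g: "g \<in> ?A" for f g
  proof (rule agree[OF g f])
    fix u assume u: "u \<in> U"
    show "B g (var u) = C g (var u)"
      unfolding poisson_bracket_onD(2)[OF B g polys_in_var[OF u]]
        poisson_bracket_onD(2)[OF C g polys_in_var[OF u]] var[OF u g] ..
  qed
  \<comment> \<open>Both brackets are \<open>undefined\<close> off the subalgebra, so agreement on
    it is equality of functions.\<close>
  have "B g = C g" if "g \<in> ?A" for g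
    using PiE_mem[OF poisson_bracket_onD(1)[OF B] that] PiE_mem[OF poisson_bracket_onD(1)[OF C] that]
    by (rule PiE_ext) (rule gens[OF _ that])
  with poisson_bracket_onD(1)[OF B] poisson_bracket_onD(1)[OF C] show ?thesis
    by (rule PiE_ext)
qed

text \<open>Since \<open>b\<close> maps \<open>U\<close> into \<open>polys_in U\<close>, inner
  brackets stay in the domain, and nested restricted brackets reduce to unrestricted ones.\<close>

lemma poisson_bracket_on_restrict_biderivation:
  fixes b :: "nat \<times> nat \<Rightarrow> nat \<times> nat \<Rightarrow> 'a::field_char_0 pair_poly"
  assumes "\<And>u v. u \<in> U \<Longrightarrow> v \<in> U \<Longrightarrow> b u v \<in> polys_in U"
    and "\<And>u v. b u v = - b v u"
    and "\<And>u v w. biderivation_extending b (var u) (b v w) + biderivation_extending b (var v) (b w u) +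
      biderivation_extending b (var w) (b u v) = 0"
  shows "poisson_bracket_on (polys_in U)
    (\<lambda>f\<in>polys_in U. \<lambda>g\<in>polys_in U. biderivation_extending b f g)"
proof -
  let ?B = "\<lambda>f\<in>polys_in U. \<lambda>g\<in>polys_in U. biderivation_extending b f g"
  have const: "const c * f \<in> polys_in U" if "f \<in> polys_in U" for c and f :: "'a pair_poly"
    using that polys_in_single[of 0 U c] by (simp add: const_def polys_in_mult)
  have B_in: "biderivation_extending b f g \<in> polys_in U" if "f \<in> polys_in U" "g \<in> polys_in U" for f g
    using that assms(1) by (rule biderivation_extending_in)
  have B_const: "biderivation_extending b (const c) g = 0" "biderivation_extending b f (const c) = 0" for c f g
    by (simp_all add: const_def biderivation_extending_const)
  have 1: "?B \<in> polys_in U \<rightarrow>\<^sub>E (polys_in U \<rightarrow>\<^sub>E polys_in U)"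
    using B_in by auto
  have 2: "?B f g = - ?B g f" if "f \<in> polys_in U" "g \<in> polys_in U" for f g
    using that biderivation_extending_skew[of b f g, OF assms(2)] by simp
  have 3: "?B f (?B g h) + ?B g (?B h f) + ?B h (?B f g) = 0"
    if "f \<in> polys_in U" "g \<in> polys_in U" "h \<in> polys_in U" for f g h
    using that biderivation_extending_jacobi[of b f g h, OF assms(2,3)] by (simp add: B_in)
  show ?thesis
    unfolding poisson_bracket_on_def
    by (intro conjI ballI allI; (rule 1 | (rule 2; assumption) | (rule 3; assumption) |
          (simp add: const polys_in_add polys_in_mult biderivation_extending_add
            biderivation_extending_mult B_const)))
qed

subsection \<open>The bracket on the generators\<close>

lemma X_eq_var: "X i j = var (i, j)"
  by (simp add: X_def var_def)

lemma sym_tensor_square_eq: "sym_tensor_square n = polys_in ({1..n} \<times> {1..n})"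
  by (simp add: sym_tensor_square_def polys_in_def)

text \<open>\<open>b\<close> models the bracket of \<open>x i j\<close> with \<open>x k l\<close>,
  and \<open>J\<close> the Leibniz expansion of the bracket of \<open>x i j\<close> with
  \<open>b k l m n\<close>. Each of the eight terms picks one index from each variable; its two
  monomials arise from \<open>x i j * x k l * x m n\<close> by rotating the picked indices
  cyclically, once in each direction.\<close>

lemma quadratic_bracket_jacobiator:
  fixes s x :: "nat \<Rightarrow> nat \<Rightarrow> 'r::comm_ring_1" and b
  assumes skew: "\<And>a b. s b a = - s a b"
  and b: "\<And>i j k l. b i j k l = (s j l + s i k) * (x i l * x k j) + (s j k + 1) * (x j l * x i k) + (s i l - 1) * (x l j * x k i)"
  and C: "\<And>a b c. C a b c = s a b * s b c + s b c * s c a + s c a * s a b + 1"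
  and J: "\<And>i j k l m n. J i j k l m n = (s l n + s k m) * (b i j k n * x m l + x k n * b i j m l)
     + (s l m + 1) * (b i j l n * x k m + x l n * b i j k m) + (s k n - 1) * (b i j n l * x m k + x n l * b i j m k)"
  shows "J i j k l m n + J k l m n i j + J m n i j k l =
    C i k m * (x k j * x m l * x i n - x m j * x i l * x k n) + 
    C i k n * (x k j * x n l * x m i - x n j * x i l * x m k) +
    C i l m * (x l j * x k m * x i n - x m j * x k i * x l n) +
    C i l n * (x l j * x k n * x m i - x n j * x k i * x m l) +
    C j k m * (x i k * x m l * x j n - x i m * x j l * x k n) + 
    C j k n * (x i k * x n l * x m j - x i n * x j l * x m k) +
    C j l m * (x i l * x k m * x j n - x i m * x k j * x l n) +
    C j l n * (x i l * x k n * x m j - x i n * x k j * x m l)"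
proof -
  \<comment> \<open>Every sign gets oriented from an earlier variable to a later one; what remains
    is a comparison of polynomials.\<close>
  note sk = skew[of i k] skew[of i l] skew[of i m] skew[of i n] skew[of j k] skew[of j l] skew[of j m] skew[of j n]
    skew[of k m] skew[of k n] skew[of l m] skew[of l n]
  show ?thesis unfolding J b C sk by (simp add: algebra_simps)
qed

text \<open>Valued in the polynomial ring, so that signs and variables lie in one commutative ring,
  as \<open>quadratic_bracket_jacobiator\<close> demands.\<close>

definition sign :: "nat \<Rightarrow> nat \<Rightarrow> 'a::field_char_0 pair_poly" where
  "sign i j = (if i < j then - 1 else if i = j then 0 else 1)"

text \<open>Each term exchanges an index of the first variable with one of the second. Exchanging
  \<open>i\<close> with \<open>k\<close> or \<open>j\<close> with \<open>l\<close> yields the same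
  monomial, hence the joint coefficient.\<close>

definition generator_bracket :: "nat \<times> nat \<Rightarrow> nat \<times> nat \<Rightarrow> 'a::field_char_0 pair_poly" where
  "generator_bracket = (\<lambda>(i, j) (k, l).
     (sign j l + sign i k) * (X i l * X k j) + (sign j k + 1) * (X j l * X i k) +
     (sign i l - 1) * (X l j * X k i))"

lemma generator_bracket_pair:
  "generator_bracket (i, j) (k, l) = (sign j l + sign i k) * (X i l * X k j) +
     (sign j k + 1) * (X j l * X i k) + (sign i l - 1) * (X l j * X k i)"
  by (simp add: generator_bracket_def)

lemma sign_skew: "sign j i = - sign i j"
  by (simp add: sign_def)

text \<open>For distinct indices two of the cyclic signs agree and the third is opposite; if exactly
  two indices coincide, one sign is 0 and the others are opposite. Either way the products sum to
  -1.\<close>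

lemma sign_cyclic: "sign a b * sign b c + sign b c * sign c a + sign c a * sign a b + 1 = (if a = b \<and> b = c then 1 else 0)"
  by (auto simp: sign_def)

lemma derivation_extending_sign: "derivation_extending D (sign i j) = 0"
  using derivation_extending_const[of D 1] derivation_extending_const[of D 0]
  by (auto simp: sign_def derivation_extending_uminus)

text \<open>Exchanging the arguments makes the last two terms trade places: on the monomial
  \<open>X j l * X i k\<close> the coefficient \<open>sign j k + 1\<close> becomes
  \<open>sign k j - 1\<close>, its negative.\<close>

lemma generator_bracket_skew: "generator_bracket u v = - generator_bracket v u"
proof (cases u, cases v)
  fix i j k l assume "u = (i, j)" "v = (k, l)"
  then show ?thesis
    by (simp add: generator_bracket_def sign_skew[of i] sign_skew[of j] algebra_simps)
qed

lemma sign_in: "sign i j \<in> polys_in U"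
  by (simp add: sign_def polys_in_0 polys_in_1 polys_in_minus)

lemma X_in: "a \<in> S \<Longrightarrow> b \<in> T \<Longrightarrow> X a b \<in> polys_in (S \<times> T)"
  by (simp add: X_eq_var polys_in_var)

lemma generator_bracket_in:
  assumes "u \<in> S \<times> S" "v \<in> S \<times> S"
  shows "generator_bracket u v \<in> polys_in (S \<times> S)"
proof (cases u, cases v)
  fix i j k l assume uv: "u = (i, j)" "v = (k, l)"
  show ?thesis
    using assms unfolding uv generator_bracket_pair
    by (intro polys_in_add polys_in_diff polys_in_mult sign_in polys_in_1) (simp_all add: X_in)
qed

section \<open>The twelve formulae and the uniform bracket\<close>

text \<open>A function of four indices as parameter covers both \<open>generator_bracket\<close> and
  the values of an unknown bracket on generators.\<close>

definition generator_formulae ::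
  "(nat \<Rightarrow> nat \<Rightarrow> nat \<Rightarrow> nat \<Rightarrow> 'a::field_char_0 pair_poly) \<Rightarrow> nat \<Rightarrow> nat \<Rightarrow> nat \<Rightarrow> nat \<Rightarrow> bool" where
  "generator_formulae b i j k l \<longleftrightarrow>
      b i j k l = (\<delta> i k + \<delta> i l + \<delta> j k + \<delta> j l) * X i j * X k l - 2 * (X i l * X k j + X k i * X l j) \<and>
      b i j l k = (\<delta> i k + \<delta> i l + \<delta> j k + \<delta> j l) * X i j * X l k - 2 * (X k j * X l i + X i k * X l j) \<and>
      b j i k l = (\<delta> i k + \<delta> i l + \<delta> j k + \<delta> j l) * X j i * X k l - 2 * (X j l * X k i + X k j * X l i) \<and>
      b j i l k = (\<delta> i k + \<delta> i l + \<delta> j k + \<delta> j l) * X j i * X l k - 2 * (X j k * X l i + X k i * X l j) \<and>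
      b i k j l = (\<delta> i j + \<delta> i l - \<delta> j k + \<delta> k l) * X i k * X j l - 2 * (X i l * X j k - X i j * X k l + X j i * X l k) \<and>
      b i k l j = (\<delta> i j + \<delta> i l - \<delta> j k + \<delta> k l) * X i k * X l j - 2 * X j k * X l i \<and>
      b k i j l = (\<delta> i j + \<delta> i l - \<delta> j k + \<delta> k l) * X j l * X k i - 2 * X j k * X l i \<and>
      b k i l j = (\<delta> i j + \<delta> i l - \<delta> j k + \<delta> k l) * X k i * X l j - 2 * X k j * X l i \<and>
      b i l j k = (\<delta> i j + \<delta> i k - \<delta> j l - \<delta> k l) * X i l * X j k + 2 * (X i j * X l k - X j i * X k l) \<and>
      b i l k j = (\<delta> i j + \<delta> i k - \<delta> j l - \<delta> k l) * X i l * X k j + 2 * (X i k * X l j - X j l * X k i) \<and>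
      b l i k j = (\<delta> i j + \<delta> i k - \<delta> j l - \<delta> k l) * X k j * X l i \<and>
      b l i j k = (\<delta> i j + \<delta> i k - \<delta> j l - \<delta> k l) * X j k * X l i"

text \<open>Splitting each inequality leaves eight index patterns, in which all signs and Kronecker
  symbols are constants. Formulae that overlap when indices coincide are consistent, being values of
  one function.\<close>

lemma generator_formulae_bracket:
  assumes "i \<le> j" "j \<le> k" "k \<le> l"
  shows "generator_formulae (\<lambda>i j k l. generator_bracket (i, j) (k, l)) i j k l"
  using assms unfolding le_less generator_formulae_def
  by (elim disjE) (simp_all add: generator_bracket_def sign_def kronecker_def algebra_simps)

text \<open>Three splittings of four indices into pairs, with two orders in each pair, give twelve
  brackets up to exchanging the arguments. The formulae for sorted indices list one of each, and
  skewness gives the rest.\<close>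

lemma generator_formulae_unique:
  assumes b: "\<And>i j k l. 1 \<le> i \<Longrightarrow> i \<le> j \<Longrightarrow> j \<le> k \<Longrightarrow> k \<le> l \<Longrightarrow> l \<le> n \<Longrightarrow> generator_formulae b i j k l"
    and c: "\<And>i j k l. 1 \<le> i \<Longrightarrow> i \<le> j \<Longrightarrow> j \<le> k \<Longrightarrow> k \<le> l \<Longrightarrow> l \<le> n \<Longrightarrow> generator_formulae c i j k l"
    and skew: "\<And>i j k l. {i, j, k, l} \<subseteq> {1..n} \<Longrightarrow> b i j k l = - b k l i j \<and> c i j k l = - c k l i j"
    and range: "{i, j, k, l} \<subseteq> {1..n}"
  shows "b i j k l = c i j k l"
proof -
  define E where "E i j k l \<longleftrightarrow> b i j k l = c i j k l" for i j k l
  have sorted: "E i j k l \<and> E i j l k \<and> E j i k l \<and> E j i l k \<and> E i k j l \<and> E i k l j \<and>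
      E k i j l \<and> E k i l j \<and> E i l j k \<and> E i l k j \<and> E l i k j \<and> E l i j k"
    if "i \<le> j" "j \<le> k" "k \<le> l" "i \<in> {1..n}" "l \<in> {1..n}" for i j k l
  proof -
    from that have "generator_formulae b i j k l" "generator_formulae c i j k l"
      by (auto intro: b c)
    then show ?thesis
      unfolding E_def generator_formulae_def by (elim conjE) (simp only: simp_thms)
  qed
  have swap: "E i j k l" if "E k l i j" "{i, j, k, l} \<subseteq> {1..n}" for i j k l
    using that(1) skew[OF that(2)] by (simp add: E_def)
  have swap: "E i j k l \<longleftrightarrow> E k l i j"
    using swap[of i j k l] swap[of k l i j] range by auto
  have "i \<in> {1..n}" "j \<in> {1..n}" "k \<in> {1..n}" "l \<in> {1..n}"
    using range by auto
  \<comment> \<open>Whatever the order of the four indices, \<open>sorted\<close> covers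
    \<open>E i j k l\<close> or \<open>E k l i j\<close>, and \<open>swap\<close> links the
    two.\<close>
  then have "E i j k l"
    using nat_le_linear[of i j] nat_le_linear[of i k] nat_le_linear[of i l]
      nat_le_linear[of j k] nat_le_linear[of j l] nat_le_linear[of k l]
    by (meson sorted swap)
  then show ?thesis by (simp add: E_def)
qed

lemma generator_bracket_jacobi:
  "biderivation_extending generator_bracket (var u) (generator_bracket v w) +
   biderivation_extending generator_bracket (var v) (generator_bracket w u) +
   biderivation_extending generator_bracket (var w) (generator_bracket u v) =
   (0 :: 'a::field_char_0 pair_poly)"
proof (cases u, cases v, cases w)
  fix i j k l m n
  assume uvw: "u = (i, j)" "v = (k, l)" "w = (m, n)"
  let ?b = "\<lambda>i j k l. generator_bracket (i, j) (k, l) :: 'a pair_poly"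
  let ?C = "\<lambda>a b c. sign a b * sign b c + sign b c * sign c a + sign c a * sign a b + 1 :: 'a pair_poly"
  let ?J = "\<lambda>i j k l m n. biderivation_extending generator_bracket (var (i, j)) (?b k l m n)"
  \<comment> \<open>The coefficient is 0 unless the indices coincide, so \<open>p\<close> need only
    vanish in that case.\<close>
  have C: "?C a b c * p = 0" if "a = b \<Longrightarrow> b = c \<Longrightarrow> p = 0" for a b c and p :: "'a pair_poly"
    using that unfolding sign_cyclic by auto
  have one: "derivation_extending D 1 = 0" for D :: "nat \<times> nat \<Rightarrow> 'a pair_poly"
    using derivation_extending_const[of D 1] by simp
  have "?J i j k l m n + ?J k l m n i j + ?J m n i j k l =
    ?C i k m * (X k j * X m l * X i n - X m j * X i l * X k n) +
    ?C i k n * (X k j * X n l * X m i - X n j * X i l * X m k) +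
    ?C i l m * (X l j * X k m * X i n - X m j * X k i * X l n) +
    ?C i l n * (X l j * X k n * X m i - X n j * X k i * X m l) +
    ?C j k m * (X i k * X m l * X j n - X i m * X j l * X k n) +
    ?C j k n * (X i k * X n l * X m j - X i n * X j l * X m k) +
    ?C j l m * (X i l * X k m * X j n - X i m * X k j * X l n) +
    ?C j l n * (X i l * X k n * X m j - X i n * X k j * X m l)"
  proof (rule quadratic_bracket_jacobiator[where b = ?b])
    fix i j k l m n
    show "?J i j k l m n = (sign l n + sign k m) * (?b i j k n * X m l + X k n * ?b i j m l)
      + (sign l m + 1) * (?b i j l n * X k m + X l n * ?b i j k m)
      + (sign k n - 1) * (?b i j n l * X m k + X n l * ?b i j m k)"
      \<comment> \<open>Only the inner bracket is expanded. The Leibniz rule, under which signs are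
        constants, leaves the outer brackets in the form \<open>?b\<close>.\<close>
      unfolding generator_bracket_pair[of k l]
      by (simp add: biderivation_extending_def derivation_extending_add derivation_extending_mult
          derivation_extending_diff derivation_extending_sign one X_eq_var algebra_simps)
  qed (rule sign_skew generator_bracket_pair refl)+
  then show ?thesis unfolding uvw
    by (simp add: C)
qed

section \<open>Existence and uniqueness of the bracket\<close>

theorem corollary1p15:
  fixes n :: nat
  shows "\<exists>!B :: 'a::field_char_0 pair_poly \<Rightarrow> 'a pair_poly \<Rightarrow> 'a pair_poly.
    poisson_bracket_on (sym_tensor_square n) B \<and>
    (\<forall>i j k l. 1 \<le> i \<and> i \<le> j \<and> j \<le> k \<and> k \<le> l \<and> l \<le> n \<longrightarrow>
      B (X i j) (X k l) = (\<delta> i k + \<delta> i l + \<delta> j k + \<delta> j l) * X i j * X k l - 2 * (X i l * X k j + X k i * X l j) \<and>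
      B (X i j) (X l k) = (\<delta> i k + \<delta> i l + \<delta> j k + \<delta> j l) * X i j * X l k - 2 * (X k j * X l i + X i k * X l j) \<and>
      B (X j i) (X k l) = (\<delta> i k + \<delta> i l + \<delta> j k + \<delta> j l) * X j i * X k l - 2 * (X j l * X k i + X k j * X l i) \<and>
      B (X j i) (X l k) = (\<delta> i k + \<delta> i l + \<delta> j k + \<delta> j l) * X j i * X l k - 2 * (X j k * X l i + X k i * X l j) \<and>
      B (X i k) (X j l) = (\<delta> i j + \<delta> i l - \<delta> j k + \<delta> k l) * X i k * X j l - 2 * (X i l * X j k - X i j * X k l + X j i * X l k) \<and>
      B (X i k) (X l j) = (\<delta> i j + \<delta> i l - \<delta> j k + \<delta> k l) * X i k * X l j - 2 * X j k * X l i \<and>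
      B (X k i) (X j l) = (\<delta> i j + \<delta> i l - \<delta> j k + \<delta> k l) * X j l * X k i - 2 * X j k * X l i \<and>
      B (X k i) (X l j) = (\<delta> i j + \<delta> i l - \<delta> j k + \<delta> k l) * X k i * X l j - 2 * X k j * X l i \<and>
      B (X i l) (X j k) = (\<delta> i j + \<delta> i k - \<delta> j l - \<delta> k l) * X i l * X j k + 2 * (X i j * X l k - X j i * X k l) \<and>
      B (X i l) (X k j) = (\<delta> i j + \<delta> i k - \<delta> j l - \<delta> k l) * X i l * X k j + 2 * (X i k * X l j - X j l * X k i) \<and>
      B (X l i) (X k j) = (\<delta> i j + \<delta> i k - \<delta> j l - \<delta> k l) * X k j * X l i \<and>
      B (X l i) (X j k) = (\<delta> i j + \<delta> i k - \<delta> j l - \<delta> k l) * X j k * X l i)"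
proof -
  let ?A = "sym_tensor_square n :: 'a pair_poly set"
  let ?b = "\<lambda>i j k l. generator_bracket (i, j) (k, l) :: 'a pair_poly"
  let ?B = "\<lambda>f\<in>?A. \<lambda>g\<in>?A. biderivation_extending generator_bracket f g"
  let ?rel = "\<lambda>B :: 'a pair_poly \<Rightarrow> 'a pair_poly \<Rightarrow> 'a pair_poly.
    \<forall>i j k l. 1 \<le> i \<and> i \<le> j \<and> j \<le> k \<and> k \<le> l \<and> l \<le> n \<longrightarrow>
      generator_formulae (\<lambda>i j k l. B (X i j) (X k l)) i j k l"
  have X_in: "X i j \<in> ?A" if "i \<in> {1..n}" "j \<in> {1..n}" for i j
    unfolding sym_tensor_square_eq using that by (rule X_in)
  have poisson: "poisson_bracket_on ?A ?B"
    unfolding sym_tensor_square_eq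
    by (intro poisson_bracket_on_restrict_biderivation generator_bracket_in generator_bracket_jacobi)
      (assumption | rule generator_bracket_skew)+
  \<comment> \<open>The bounds matter: outside them the generators leave the subalgebra and
    \<open>?B\<close> is \<open>undefined\<close>.\<close>
  have B_gens: "?B (X i j) (X k l) = ?b i j k l"
    if "i \<in> {1..n}" "j \<in> {1..n}" "k \<in> {1..n}" "l \<in> {1..n}" for i j k l
    using that by (simp add: X_in del: atLeastAtMost_iff) (simp add: X_eq_var)
  have rel: "?rel ?B"
  proof (intro allI impI)
    fix i j k l assume *: "1 \<le> i \<and> i \<le> j \<and> j \<le> k \<and> k \<le> l \<and> l \<le> n"
    then have "generator_formulae ?b i j k l"
      by (intro generator_formulae_bracket) auto
    moreover have "i \<in> {1..n}" "j \<in> {1..n}" "k \<in> {1..n}" "l \<in> {1..n}" using * by auto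
    ultimately show "generator_formulae (\<lambda>i j k l. ?B (X i j) (X k l)) i j k l"
      unfolding generator_formulae_def by (simp only: B_gens)
  qed
  \<comment> \<open>The generators with indices in \<open>{1..n}\<close> are exactly the variables
    of the subalgebra, so agreement on them determines the bracket.\<close>
  have unique: "B = C" if B: "poisson_bracket_on ?A B" "?rel B" and C: "poisson_bracket_on ?A C" "?rel C" for B C
  proof (rule poisson_bracket_on_eqI)
    show "poisson_bracket_on (polys_in ({1..n} \<times> {1..n})) B" "poisson_bracket_on (polys_in ({1..n} \<times> {1..n})) C"
      using B(1) C(1) by (simp_all add: sym_tensor_square_eq)
    fix u v assume uv: "u \<in> {1..n} \<times> {1..n}" "v \<in> {1..n} \<times> {1..n}"
    then obtain i j k l where "u = (i, j)" "v = (k, l)" and range: "{i, j, k, l} \<subseteq> {1..n}"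
      by auto
    moreover have "B (X i j) (X k l) = C (X i j) (X k l)"
    proof (rule generator_formulae_unique[where b = "\<lambda>i j k l. B (X i j) (X k l)"
          and c = "\<lambda>i j k l. C (X i j) (X k l)", OF _ _ _ range])
      fix i j k l
      show "generator_formulae (\<lambda>i j k l. B (X i j) (X k l)) i j k l"
        and "generator_formulae (\<lambda>i j k l. C (X i j) (X k l)) i j k l"
        if "1 \<le> i" "i \<le> j" "j \<le> k" "k \<le> l" "l \<le> n"
        by (rule B(2)[rule_format] C(2)[rule_format]; use that in simp)+
      assume "{i, j, k, l} \<subseteq> {1..n}"
      then show "B (X i j) (X k l) = - B (X k l) (X i j) \<and> C (X i j) (X k l) = - C (X k l) (X i j)"
        by (intro conjI poisson_bracket_onD(2)[OF B(1)] poisson_bracket_onD(2)[OF C(1)] X_in) auto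
    qed
    ultimately show "B (var u) (var v) = C (var u) (var v)"
      by (simp add: X_eq_var)
  qed
  have "\<exists>!B. poisson_bracket_on ?A B \<and> ?rel B"
  proof (rule ex1I)
    show "poisson_bracket_on ?A ?B \<and> ?rel ?B"
      using poisson rel by (rule conjI)
    show "C = ?B" if "poisson_bracket_on ?A C \<and> ?rel C" for C
      by (rule unique[OF conjunct1[OF that] conjunct2[OF that] poisson rel])
  qed
  then show ?thesis
    unfolding generator_formulae_def .
qed

end
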